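(* For $n=2$, the quasi-eigenfunction $F(\alpha)=F(\zeta_1,\zeta_2;\alpha,q,t)$ satisfies $$F(-t^{1/2})=(1-\zeta_2/\zeta_1)\frac{(-qt^{-1/2}\zeta_2/\zeta_1;q)_\infty}{(-t^{1/2}\zeta_2/\zeta_1;q)_\infty},\qquad F(t)=\prod_{1\le i<j\le 2,\ j-i\ \mathrm{even}}(1-\zeta_j/\zeta_i)\frac{(qt^{-1}\zeta_j/\zeta_i;q)_\infty}{(t\zeta_j/\zeta_i;q)_\infty}=1$$ (the last product being empty).
   Context: $(a;q)_\infty=\prod_{k\ge0}(1-aq^k)$, $(a;q)_k=\prod_{i=0}^{k-1}(1-aq^i)$, with $|q|<1$ and $t$ generic. For $n=2$ the quasi-eigenfunction is the formal power series in $\zeta_2/\zeta_1$ $$F(\zeta_1,\zeta_2;\alpha,q,t)=(1-\zeta_2/\zeta_1)\sum_{k\ge0}\frac{(qt^{-1};q)_k(\alpha qt^{-1};q)_k}{(q;q)_k(\alpha^{-1}q;q)_k}(\alpha^{-1}t\,\zeta_2/\zeta_1)^k .$$ *)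

theory Defs
  imports "HOL-Analysis.Analysis" "HOL-Computational_Algebra.Formal_Power_Series"
begin

definition qpoch :: "'a::comm_ring_1 \<Rightarrow> 'a \<Rightarrow> nat \<Rightarrow> 'a" where
  "qpoch a q k = (\<Prod>i<k. 1 - a * q ^ i)"

text \<open>The infinite product \<open>(u; q)\<^sub>\<infinity>\<close> for a formal power series \<open>u\<close> and a complex number \<open>q\<close>.
  The limit is taken coefficientwise in the topology of the complex numbers: the factors
  \<open>1 - u q\<^sup>k\<close> do not tend to \<open>1\<close> in the \<open>X\<close>-adic topology that the library
  puts on formal power series, so the library's infinite product does not apply.
  For \<open>|q| < 1\<close> the limit exists, see \<open>qpoch_inf_LIMSEQ\<close>.\<close>

definition qpoch_inf :: "complex fps \<Rightarrow> complex \<Rightarrow> complex fps" where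
  "qpoch_inf u q = Abs_fps (\<lambda>n. lim (\<lambda>N. fps_nth (qpoch u (fps_const q) N) n))"

lemma qpoch_inf_LIMSEQ:
  assumes q: "norm q < 1"
  shows "(\<lambda>N. fps_nth (qpoch u (fps_const q) N) n) \<longlonglongrightarrow> fps_nth (qpoch_inf u q) n"
proof -
  define A where "A f = (\<Sum>m\<le>n. norm (fps_nth f m))" for f :: "complex fps"
  have A_nonneg: "A f \<ge> 0" for f
    unfolding A_def by (intro sum_nonneg) auto
  have A_add: "A (f + g) \<le> A f + A g" for f g
    unfolding A_def sum.distrib [symmetric] by (intro sum_mono) (auto intro: norm_triangle_ineq)
  have A_mult: "A (f * g) \<le> A f * A g" for f g
  proof -
    have "A (f * g) \<le> (\<Sum>m\<le>n. \<Sum>i\<le>m. norm (fps_nth f i) * norm (fps_nth g (m - i)))"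
      unfolding A_def fps_mult_nth
      by (intro sum_mono) (auto simp: atLeast0AtMost norm_mult[symmetric] intro: norm_sum)
    also have "\<dots> = (\<Sum>(i,j)\<in>{(i,j). i + j \<le> n}. norm (fps_nth f i) * norm (fps_nth g j))"
      by (rule sum.triangle_reindex_eq [symmetric])
    also have "\<dots> \<le> (\<Sum>(i,j)\<in>{..n} \<times> {..n}. norm (fps_nth f i) * norm (fps_nth g j))"
      by (intro sum_mono2) auto
    also have "\<dots> = A f * A g"
      unfolding A_def by (simp add: sum_product sum.cartesian_product)
    finally show ?thesis .
  qed
  have A_const: "A (fps_const c * f) = norm c * A f" for c f
    unfolding A_def by (simp add: norm_mult sum_distrib_left)
  have A_1: "A 1 = 1"
    unfolding A_def by (simp add: sum.delta if_distrib[of norm] cong: if_cong)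
  define P where "P N = qpoch u (fps_const q) N" for N
  have P_Suc: "P (Suc N) = P N + fps_const (- (q ^ N)) * (u * P N)" for N
    by (simp add: P_def qpoch_def fps_const_power algebra_simps flip: fps_const_neg)
  have bound: "A (P N) \<le> exp (A u * (\<Sum>k<N. norm q ^ k))" for N
  proof (induction N)
    case 0
    then show ?case by (simp add: P_def qpoch_def A_1)
  next
    case (Suc N)
    have "A (P (Suc N)) \<le> A (P N) + norm q ^ N * (A u * A (P N))"
      unfolding P_Suc
      by (rule order.trans[OF A_add])
         (auto simp: A_const norm_power intro!: mult_left_mono A_mult simp del: fps_const_neg)
    also have "\<dots> = (1 + A u * norm q ^ N) * A (P N)"
      by (simp add: algebra_simps)
    also have "\<dots> \<le> exp (A u * norm q ^ N) * exp (A u * (\<Sum>k<N. norm q ^ k))"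
      by (intro mult_mono Suc.IH exp_ge_add_one_self) (auto simp: A_nonneg)
    also have "\<dots> = exp (A u * (\<Sum>k<Suc N. norm q ^ k))"
      by (simp add: exp_add[symmetric] algebra_simps)
    finally show ?case .
  qed
  define B where "B = exp (A u * (1 / (1 - norm q)))"
  have bound': "A (P N) \<le> B" for N
  proof -
    have "(\<Sum>k<N. norm q ^ k) \<le> (\<Sum>k. norm q ^ k)"
      using q by (intro sum_le_suminf summable_geometric) auto
    also have "\<dots> = 1 / (1 - norm q)"
      using q by (intro suminf_geometric) auto
    finally show ?thesis
      using bound[of N] A_nonneg[of u] unfolding B_def
      by (meson order.trans exp_le_cancel_iff mult_left_mono)
  qed
  have coeff_le: "norm (fps_nth f n) \<le> A f" for f
    unfolding A_def by (rule member_le_sum) auto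
  have "summable (\<lambda>N. fps_nth (P (Suc N)) n - fps_nth (P N) n)"
  proof (rule summable_comparison_test')
    show "summable (\<lambda>N. (A u * B) * norm q ^ N)"
      using q by (intro summable_mult summable_geometric) auto
    fix N :: nat
    have "norm (fps_nth (P (Suc N)) n - fps_nth (P N) n) = norm q ^ N * norm (fps_nth (u * P N) n)"
      unfolding P_Suc by (simp add: norm_mult norm_power del: fps_const_neg)
    also have "\<dots> \<le> norm q ^ N * (A u * B)"
      by (intro mult_left_mono order.trans[OF coeff_le] order.trans[OF A_mult] bound' A_nonneg) auto
    finally show "norm (fps_nth (P (Suc N)) n - fps_nth (P N) n) \<le> (A u * B) * norm q ^ N"
      by (simp add: mult.commute)
  qed
  then have "convergent (\<lambda>N. \<Sum>k<N. fps_nth (P (Suc k)) n - fps_nth (P k) n)"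
    by (simp add: summable_iff_convergent)
  then have "convergent (\<lambda>N. fps_nth (P N) n - fps_nth (P 0) n)"
    by (simp only: sum_lessThan_telescope[of "\<lambda>k. fps_nth (P k) n"])
  then have "convergent (\<lambda>N. fps_nth (P N) n)"
    using convergent_add[OF _ convergent_const[of "fps_nth (P 0) n"]] by fastforce
  then show ?thesis
    by (simp add: qpoch_inf_def P_def convergent_LIMSEQ_iff)
qed

text \<open>The case \<open>n = 2\<close>: everything is a formal power series in \<open>X = \<zeta>\<^sub>2/\<zeta>\<^sub>1\<close>.\<close>

definition quasi_eigenfunction :: "complex \<Rightarrow> complex \<Rightarrow> complex \<Rightarrow> complex fps" where
  "quasi_eigenfunction \<alpha> q t =
     (1 - fps_X) *
     Abs_fps (\<lambda>k. qpoch (q * inverse t) q k * qpoch (\<alpha> * q * inverse t) q k /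
                  (qpoch q q k * qpoch (inverse \<alpha> * q) q k) * (inverse \<alpha> * t) ^ k)"

text \<open>\<open>\<zeta>\<^sub>j/\<zeta>\<^sub>i\<close> for \<open>1 \<le> i \<le> j \<le> 2\<close>; the only case with \<open>i < j\<close> is \<open>\<zeta>\<^sub>2/\<zeta>\<^sub>1 = X\<close>.\<close>

definition zeta_ratio :: "nat \<Rightarrow> nat \<Rightarrow> complex fps" where
  "zeta_ratio j i = fps_X ^ (j - i)"

end

theory Submission
  imports Defs
begin

text \<open>For \<open>\<alpha> = t\<close> all factors in the coefficients cancel and the series is \<open>1 / (1 - X)\<close>.
  For \<open>\<alpha> = -\<surd>t\<close> the second \<open>q\<close>-Pochhammer symbols cancel and the claim is the \<open>q\<close>-binomial
  theorem \<open>\<Sum>\<^sub>k (a; q)\<^sub>k / (q; q)\<^sub>k (z X)\<^sup>k = (a z X; q)\<^sub>\<infinity> / (z X; q)\<^sub>\<infinity>\<close>. Writing \<open>f\<close> for the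
  left-hand side, both \<open>f \<cdot> (z X; q)\<^sub>\<infinity>\<close> and \<open>(a z X; q)\<^sub>\<infinity>\<close> solve the \<open>q\<close>-difference equation
  \<open>h(X) = (1 - a z X) h(q X)\<close> with \<open>h(0) = 1\<close>, and this equation determines all coefficients
  because \<open>q\<^sup>n \<noteq> 1\<close> for \<open>n \<ge> 1\<close>.\<close>

unbundle no vec_syntax
unbundle fps_syntax

lemma power_neq_1_of_norm_less_1:
  fixes q :: "'a::real_normed_div_algebra"
  assumes "norm q < 1" "n > 0"
  shows "q ^ n \<noteq> 1"
proof
  assume "q ^ n = 1"
  then have "norm q ^ n = 1"
    by (metis norm_one norm_power)
  moreover have "norm q ^ n < 1"
    using assms by (simp add: power_less_one_iff)
  ultimately show False
    by simp
qed

lemma qpoch_nonzero_iff: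
  fixes a q :: "'a::idom"
  shows "qpoch a q k \<noteq> 0 \<longleftrightarrow> (\<forall>i<k. a * q ^ i \<noteq> 1)"
  by (auto simp: qpoch_def)

lemma qpoch_rec: "qpoch a q (Suc k) = (1 - a) * qpoch (a * q) q k"
  by (simp add: qpoch_def prod.lessThan_Suc_shift mult.assoc del: prod.lessThan_Suc)

text \<open>Peeling off the factor at index 0 (\<open>qpoch_rec\<close>) survives the limit because
  each coefficient of a product is a finite sum of products of coefficients.\<close>

lemma qpoch_inf_rec:
  assumes "norm q < 1"
  shows "qpoch_inf u q = (1 - u) * qpoch_inf (u * fps_const q) q"
proof (rule fps_ext)
  fix n
  let ?P = "\<lambda>N. qpoch (u * fps_const q) (fps_const q) N"
  have "(\<lambda>N. ((1 - u) * ?P N) $ n) \<longlonglongrightarrow> ((1 - u) * qpoch_inf (u * fps_const q) q) $ n"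
    unfolding fps_mult_nth by (intro tendsto_intros qpoch_inf_LIMSEQ assms)
  then have "(\<lambda>N. qpoch u (fps_const q) (Suc N) $ n)
      \<longlonglongrightarrow> ((1 - u) * qpoch_inf (u * fps_const q) q) $ n"
    by (simp add: qpoch_rec)
  then show "qpoch_inf u q $ n = ((1 - u) * qpoch_inf (u * fps_const q) q) $ n"
    using LIMSEQ_Suc[OF qpoch_inf_LIMSEQ[OF assms]] LIMSEQ_unique by blast
qed

lemma qpoch_inf_nth_0:
  assumes "norm q < 1" "u $ 0 = 0"
  shows "qpoch_inf u q $ 0 = 1"
proof -
  have "qpoch u (fps_const q) N $ 0 = 1" for N
    by (induction N) (simp_all add: qpoch_def assms(2))
  then show ?thesis
    using qpoch_inf_LIMSEQ[OF assms(1), of u 0] by (simp add: LIMSEQ_const_iff)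
qed

text \<open>Substituting \<open>c X\<close> for \<open>X\<close> is a ring homomorphism, so it
  passes through finite products; it scales the \<open>n\<close>-th coefficient by
  \<open>c ^ n\<close>, so it also passes through the coefficientwise limit.\<close>

lemma qpoch_inf_compose_linear:
  assumes "norm q < 1"
  shows "qpoch_inf u q oo (fps_const c * fps_X) = qpoch_inf (u oo (fps_const c * fps_X)) q"
proof (rule fps_ext)
  fix n
  let ?X = "fps_const c * fps_X"
  have "qpoch u (fps_const q) N oo ?X = qpoch (u oo ?X) (fps_const q) N" for N
    by (simp add: qpoch_def fps_compose_prod_distrib fps_compose_sub_distrib
        fps_compose_mult_distrib fps_const_power)
  then have "(\<lambda>N. c ^ n * qpoch u (fps_const q) N $ n) = (\<lambda>N. qpoch (u oo ?X) (fps_const q) N $ n)"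
    by (metis fps_compose_linear fps_nth_Abs_fps)
  moreover have "(\<lambda>N. c ^ n * qpoch u (fps_const q) N $ n) \<longlonglongrightarrow> c ^ n * qpoch_inf u q $ n"
    by (intro tendsto_intros qpoch_inf_LIMSEQ assms)
  ultimately have "qpoch_inf (u oo ?X) q $ n = c ^ n * qpoch_inf u q $ n"
    using qpoch_inf_LIMSEQ[OF assms] LIMSEQ_unique by metis
  then show "(qpoch_inf u q oo ?X) $ n = qpoch_inf (u oo ?X) q $ n"
    by (simp add: fps_compose_linear)
qed

text \<open>For \<open>u = c X\<close>, the shift from \<open>u\<close> to \<open>u q\<close> in
  \<open>qpoch_inf_rec\<close> is the substitution of \<open>q X\<close> for
  \<open>X\<close>.\<close>

lemma qpoch_inf_functional_equation:
  assumes "norm q < 1"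
  shows "qpoch_inf (fps_const c * fps_X) q = (1 - fps_const c * fps_X) *
    (qpoch_inf (fps_const c * fps_X) q oo (fps_const q * fps_X))"
proof -
  have "(fps_const c * fps_X) oo (fps_const q * fps_X) = fps_const c * fps_X * fps_const q"
    by (simp add: fps_compose_mult_distrib mult_ac)
  then show ?thesis
    using qpoch_inf_rec[OF assms, of "fps_const c * fps_X"]
    by (metis qpoch_inf_compose_linear[OF assms])
qed

lemma fps_q_difference_unique:
  fixes f g :: "'a::idom fps"
  assumes q: "\<And>n. n > 0 \<Longrightarrow> q ^ n \<noteq> 1"
    and f: "f = (1 - fps_const c * fps_X) * (f oo (fps_const q * fps_X))"
    and g: "g = (1 - fps_const c * fps_X) * (g oo (fps_const q * fps_X))"
    and "f $ 0 = g $ 0"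
  shows "f = g"
proof (rule fps_ext)
  fix n
  \<comment> \<open>Compare coefficients of \<open>X ^ Suc n\<close>: the factor \<open>c X\<close>
    contributes the previous coefficient of \<open>h(q X)\<close>, hence \<open>q ^ n\<close> on the
    right.\<close>
  have rec: "(1 - q ^ Suc n) * h $ Suc n = - c * q ^ n * h $ n"
    if "h = (1 - fps_const c * fps_X) * (h oo (fps_const q * fps_X))" for h n
  proof -
    have "h $ Suc n = ((1 - fps_const c * fps_X) * (h oo (fps_const q * fps_X))) $ Suc n"
      using that by simp
    then show ?thesis
      unfolding fps_compose_linear
      by (simp add: left_diff_distrib mult.assoc) (simp add: algebra_simps)
  qed
  show "f $ n = g $ n"
  proof (induction n)
    case (Suc n)
    have "(1 - q ^ Suc n) * f $ Suc n = (1 - q ^ Suc n) * g $ Suc n"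
      by (simp only: rec[OF f] rec[OF g] Suc)
    moreover have "1 - q ^ Suc n \<noteq> 0"
      using q[of "Suc n"] by simp
    ultimately show ?case
      using mult_left_cancel by blast
  qed (use assms in simp)
qed

theorem q_binomial:
  fixes a z q :: complex
  assumes q: "norm q < 1"
  shows "Abs_fps (\<lambda>k. qpoch a q k / qpoch q q k * z ^ k) =
    qpoch_inf (fps_const (a * z) * fps_X) q / qpoch_inf (fps_const z * fps_X) q"
proof -
  define f where "f = Abs_fps (\<lambda>k. qpoch a q k / qpoch q q k * z ^ k)"
  define P where "P c = qpoch_inf (fps_const c * fps_X) q" for c
  let ?X = "fps_const q * fps_X"
  have q1: "q ^ n \<noteq> 1" if "n > 0" for n
    using power_neq_1_of_norm_less_1[OF q that] .
  \<comment> \<open>In coefficients this is the recurrence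
    \<open>(1 - q ^ Suc m) * f $ Suc m = z * (1 - a * q ^ m) * f $ m\<close>, read off from the
    quotient of Pochhammer symbols.\<close>
  have f_eq: "(1 - fps_const z * fps_X) * f = (1 - fps_const (a * z) * fps_X) * (f oo ?X)"
  proof (rule fps_ext)
    fix n
    show "((1 - fps_const z * fps_X) * f) $ n = ((1 - fps_const (a * z) * fps_X) * (f oo ?X)) $ n"
    proof (cases n)
      case (Suc m)
      have "qpoch q q m \<noteq> 0"
        using q1 by (simp add: qpoch_nonzero_iff flip: power_Suc)
      moreover have "1 - q ^ Suc m \<noteq> 0"
        using q1[of "Suc m"] by simp
      moreover have "f $ Suc m = qpoch a q m * (1 - a * q ^ m) /
          (qpoch q q m * (1 - q ^ Suc m)) * (z ^ m * z)"
        by (simp add: f_def qpoch_def)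
      ultimately have "(1 - q ^ Suc m) * f $ Suc m = z * (1 - a * q ^ m) * f $ m"
        by (simp add: f_def)
      then show ?thesis
        unfolding Suc fps_compose_linear
        by (simp add: left_diff_distrib mult.assoc) (simp add: algebra_simps)
    qed (simp add: fps_compose_linear)
  qed
  have P0: "P c $ 0 = 1" for c
    by (simp add: P_def qpoch_inf_nth_0[OF q])
  have P_eq: "P c = (1 - fps_const c * fps_X) * (P c oo ?X)" for c
    unfolding P_def by (rule qpoch_inf_functional_equation[OF q])
  \<comment> \<open>The factor \<open>1 - z X\<close> released by \<open>P z\<close> is what
    \<open>f_eq\<close> needs to turn \<open>f\<close> into \<open>f(q X)\<close>, leaving
    \<open>1 - a z X\<close>.\<close>
  have "f * P z = (1 - fps_const z * fps_X) * f * (P z oo ?X)"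
    by (subst P_eq) (simp only: mult_ac)
  also have "\<dots> = (1 - fps_const (a * z) * fps_X) * (f * P z oo ?X)"
    by (simp add: f_eq fps_compose_mult_distrib mult.assoc)
  finally have fP_eq: "f * P z = (1 - fps_const (a * z) * fps_X) * (f * P z oo ?X)" .
  have "(f * P z) $ 0 = P (a * z) $ 0"
    by (simp add: P0 f_def qpoch_def)
  then have "f * P z = P (a * z)"
    using fps_q_difference_unique q1 fP_eq P_eq by blast
  moreover have "P z \<noteq> 0"
    using P0[of z] by auto
  ultimately show ?thesis
    unfolding f_def P_def by (metis nonzero_mult_div_cancel_right)
qed

theorem proposition7p2:
  fixes q t s :: complex
  assumes "norm q < 1"
    and "t \<noteq> 0"
    and "\<And>k::nat. k \<ge> 1 \<Longrightarrow> t \<noteq> q ^ k"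
    and "s\<^sup>2 = t"
  shows
    "quasi_eigenfunction (- s) q t =
       (1 - zeta_ratio 2 1) *
       (qpoch_inf (fps_const (- q * inverse s) * zeta_ratio 2 1) q /
        qpoch_inf (fps_const (- s) * zeta_ratio 2 1) q)
     \<and>
     quasi_eigenfunction t q t =
       (\<Prod>(i, j)\<in>{(i, j). 1 \<le> i \<and> i < j \<and> j \<le> (2::nat) \<and> even (j - i)}.
          (1 - zeta_ratio j i) *
          (qpoch_inf (fps_const (q * inverse t) * zeta_ratio j i) q /
           qpoch_inf (fps_const t * zeta_ratio j i) q))
     \<and>
     (\<Prod>(i, j)\<in>{(i, j). 1 \<le> i \<and> i < j \<and> j \<le> (2::nat) \<and> even (j - i)}.
          (1 - zeta_ratio j i) *
          (qpoch_inf (fps_const (q * inverse t) * zeta_ratio j i) q /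
           qpoch_inf (fps_const t * zeta_ratio j i) q)) = 1"
proof -
  have empty: "{(i, j). 1 \<le> i \<and> i < j \<and> j \<le> (2::nat) \<and> even (j - i)} = {}"
  proof -
    have "odd (j - i)" if "1 \<le> i" "i < j" "j \<le> 2" for i j :: nat
    proof -
      have "j - i = 1" using that by linarith
      then show ?thesis by simp
    qed
    then show ?thesis by blast
  qed
  have s: "s \<noteq> 0"
    using assms by auto
  have q1: "q * q ^ i \<noteq> 1" for i
    using power_neq_1_of_norm_less_1[OF assms(1), of "Suc i"] by simp
  \<comment> \<open>A vanishing factor would force \<open>t = q ^ Suc i\<close>. Hence the symbols
    cancelled for \<open>\<alpha> = t\<close> are nonzero and no quotient 0/0 occurs.\<close>
  have "qpoch (q * inverse t) q k \<noteq> 0" for k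
    using assms(2) assms(3)[of "Suc i" for i] by (auto simp: qpoch_nonzero_iff field_simps)
  moreover have "qpoch q q k \<noteq> 0" for k
    using q1 by (simp add: qpoch_nonzero_iff)
  moreover have t_eqs: "t * q * inverse t = q" "inverse t * q = q * inverse t" "inverse t * t = 1"
    using assms(2) by simp_all
  ultimately have "quasi_eigenfunction t q t = (1 - fps_X) * Abs_fps (\<lambda>k. 1)"
    unfolding quasi_eigenfunction_def t_eqs by simp
  then have F_t: "quasi_eigenfunction t q t = 1"
    by (simp add: fps_eq_iff left_diff_distrib)
  \<comment> \<open>The symbol to be cancelled for \<open>\<alpha> = - s\<close>: a zero would make
    \<open>t\<close>, the square of \<open>s\<close>, an even positive power of
    \<open>q\<close>.\<close>
  have "qpoch (- (q * inverse s)) q k \<noteq> 0" for k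
    unfolding qpoch_nonzero_iff
  proof (intro allI impI notI)
    fix i
    assume "- (q * inverse s) * q ^ i = 1"
    then have "s = - (q ^ Suc i)"
      using s by (simp add: field_simps)
    then have "t = q ^ (2 * Suc i)"
      using assms(4) by (metis power2_minus power_even_eq)
    then show False
      using assms(3)[of "2 * Suc i"] by simp
  qed
  \<comment> \<open>Since \<open>t = s * s\<close>, both second symbols have base
    \<open>- q / s\<close>, and the binomial theorem applies with \<open>a = q / t\<close>,
    \<open>z = - s\<close>, so \<open>a z = - q / s\<close>.\<close>
  moreover have "- s * q * inverse t = - (q * inverse s)" "inverse (- s) * q = - (q * inverse s)"
    "inverse (- s) * t = - s" "q * inverse t * - s = - q * inverse s"
    using s by (simp_all add: assms(4)[symmetric] power2_eq_square field_simps)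
  ultimately have "quasi_eigenfunction (- s) q t = (1 - fps_X) *
      (qpoch_inf (fps_const (- q * inverse s) * fps_X) q / qpoch_inf (fps_const (- s) * fps_X) q)"
    using q_binomial[OF assms(1), of "q * inverse t" "- s"]
    by (simp only: quasi_eigenfunction_def mult_divide_mult_cancel_right not_False_eq_True)
  then show ?thesis
    by (simp only: empty F_t prod.empty zeta_ratio_def) simp
qed

end
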